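(* Let $R$ be a finite-dimensional non-nilpotent solvable Leibniz algebra over a field of characteristic zero whose nilradical is (isomorphic to) $NF_n$. Then there exists a basis $\{e_1,e_2,\dots,e_n,x\}$ of $R$ such that the multiplication table of $R$ with respect to this basis is $$[e_i,e_1]=e_{i+1}\ (1\le i\le n-1),\qquad [x,e_1]=e_1,\qquad [e_i,x]=-i\,e_i\ (1\le i\le n),$$ all other products of basis elements being zero.
   Context: A Leibniz algebra over a field $F$ is an $F$-vector space $L$ with a bilinear bracket $[-,-]$ satisfying $[x,[y,z]] = [[x,y],z] - [[x,z],y]$ for all $x,y,z\in L$. The lower central series is $L^1=L$, $L^{k+1}=[L^k,L]$, and the derived series is $L^{[1]}=L$, $L^{[s+1]}=[L^{[s]},L^{[s]}]$. $L$ is nilpotent if $L^n=0$ for some $n$, and solvable if $L^{[m]}=0$ for some $m$. The nilradical of $L$ is its maximal nilpotent two-sided ideal. $NF_n$ denotes the $n$-dimensional null-filiform Leibniz algebra, with basis $\{e_1,\dots,e_n\}$ and multiplication $[e_i,e_1]=e_{i+1}$ for $1\le i\le n-1$, all other products of basis elements being zero.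
   Formalization: The formal statement assumes n ≥ 2; for n = 1 the claim fails: the algebra with basis {e,x} and only nonzero product [e,x] = -e is solvable, non-nilpotent, has nilradical NF_1, but is not a Lie algebra, whereas the claimed table is. *)

theory Defs
  imports Complex_Main
begin

locale leibniz_algebra = vector_space scale
  for scale :: "'f::field \<Rightarrow> 'a::ab_group_add \<Rightarrow> 'a" +
  fixes bracket :: "'a \<Rightarrow> 'a \<Rightarrow> 'a"
  assumes linear_bracket_right: "Vector_Spaces.linear scale scale (\<lambda>y. bracket x y)"
    and linear_bracket_left: "Vector_Spaces.linear scale scale (\<lambda>x. bracket x y)"
    and leibniz_identity:
      "bracket x (bracket y z) = bracket (bracket x y) z - bracket (bracket x z) y"
begin

definition bracket_span :: "'a set \<Rightarrow> 'a set \<Rightarrow> 'a set" where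
  "bracket_span A B = span {bracket a b | a b. a \<in> A \<and> b \<in> B}"

text \<open>Indices are shifted by one: \<open>lower_central A k\<close> is \<open>A\<^sup>k\<^sup>+\<^sup>1\<close> and
  \<open>derived A k\<close> is \<open>A\<^sup>[\<^sup>k\<^sup>+\<^sup>1\<^sup>]\<close>. Both are the series of the subalgebra
  \<open>A\<close> itself, not relative to the ambient algebra; the whole algebra is \<open>A = UNIV\<close>.\<close>

primrec lower_central :: "'a set \<Rightarrow> nat \<Rightarrow> 'a set" where
  "lower_central A 0 = A"
| "lower_central A (Suc k) = bracket_span (lower_central A k) A"

primrec derived :: "'a set \<Rightarrow> nat \<Rightarrow> 'a set" where
  "derived A 0 = A"
| "derived A (Suc k) = bracket_span (derived A k) (derived A k)"

definition nilpotent :: "'a set \<Rightarrow> bool" where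
  "nilpotent A \<longleftrightarrow> (\<exists>k. lower_central A k = {0})"

definition solvable :: "'a set \<Rightarrow> bool" where
  "solvable A \<longleftrightarrow> (\<exists>k. derived A k = {0})"

definition two_sided_ideal :: "'a set \<Rightarrow> bool" where
  "two_sided_ideal I \<longleftrightarrow>
     subspace I \<and> (\<forall>a\<in>I. \<forall>y. bracket a y \<in> I \<and> bracket y a \<in> I)"

text \<open>Maximality is with respect to inclusion; that a finite-dimensional algebra has
  only one such ideal is not built into the definition.\<close>

definition is_nilradical :: "'a set \<Rightarrow> bool" where
  "is_nilradical N \<longleftrightarrow>
     two_sided_ideal N \<and> nilpotent N \<and>
     (\<forall>I. two_sided_ideal I \<and> nilpotent I \<and> N \<subseteq> I \<longrightarrow> I = N)"

end

text \<open>The null-filiform algebra \<open>NF\<^sub>n\<close> is realised on the coordinate vectors supported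
  on \<open>{1..n}\<close>; its bracket is the bilinear extension of the multiplication table.\<close>

definition NF_carrier :: "nat \<Rightarrow> (nat \<Rightarrow> 'f::field) set" where
  "NF_carrier n = {v. \<forall>k. k \<notin> {1..n} \<longrightarrow> v k = 0}"

definition NF_basis :: "nat \<Rightarrow> nat \<Rightarrow> 'f::field" where
  "NF_basis i = (\<lambda>k. if k = i then 1 else 0)"

definition NF_table :: "nat \<Rightarrow> nat \<Rightarrow> nat \<Rightarrow> (nat \<Rightarrow> 'f::field)" where
  "NF_table n i j =
     (if 1 \<le> i \<and> i \<le> n - 1 \<and> j = 1 then NF_basis (i + 1) else (\<lambda>k. 0))"

definition NF_bracket ::
    "nat \<Rightarrow> (nat \<Rightarrow> 'f::field) \<Rightarrow> (nat \<Rightarrow> 'f) \<Rightarrow> (nat \<Rightarrow> 'f)" where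
  "NF_bracket n v w = (\<lambda>k. \<Sum>i=1..n. \<Sum>j=1..n. v i * w j * NF_table n i j k)"

lemma NF_bracket_apply:
  "NF_bracket n v w k = (if 2 \<le> k \<and> k \<le> n then v (k - 1) * w 1 else 0)"
proof -
  have "NF_bracket n v w k = (\<Sum>i=1..n. if i = k - 1 \<and> 2 \<le> k \<and> k \<le> n then v i * w 1 else 0)"
    unfolding NF_bracket_def
  proof (rule sum.cong)
    fix i assume i: "i \<in> {1..n}"
    have "(\<Sum>j=1..n. v i * w j * NF_table n i j k)
        = (\<Sum>j=1..n. if j = 1 then v i * w 1 * NF_table n i 1 k else 0)"
      by (rule sum.cong) (auto simp: NF_table_def)
    also have "\<dots> = v i * w 1 * NF_table n i 1 k"
      using i by simp
    also have "\<dots> = (if i = k - 1 \<and> 2 \<le> k \<and> k \<le> n then v i * w 1 else 0)"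
      using i by (auto simp: NF_table_def NF_basis_def)
    finally show "(\<Sum>j=1..n. v i * w j * NF_table n i j k)
        = (if i = k - 1 \<and> 2 \<le> k \<and> k \<le> n then v i * w 1 else 0)" .
  qed simp
  also have "\<dots> = (if 2 \<le> k \<and> k \<le> n then v (k - 1) * w 1 else 0)"
    by (auto simp: sum.delta)
  finally show ?thesis .
qed

lemma NF_bracket_closed: "NF_bracket n v w \<in> NF_carrier n"
  by (auto simp: NF_carrier_def NF_bracket_apply)

lemma NF_bracket_basis:
  assumes "i \<in> {1..n}" "j \<in> {1..n}"
  shows "NF_bracket n (NF_basis i) (NF_basis j) = NF_table n i j"
  using assms by (auto simp: fun_eq_iff NF_bracket_apply NF_table_def NF_basis_def)

lemma NF_leibniz_identity:
  "NF_bracket n u (NF_bracket n v w)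
     = (\<lambda>k. NF_bracket n (NF_bracket n u v) w k - NF_bracket n (NF_bracket n u w) v k)"
  by (auto simp: fun_eq_iff NF_bracket_apply)

context leibniz_algebra
begin

definition isomorphic_to_NF :: "nat \<Rightarrow> 'a set \<Rightarrow> bool" where
  "isomorphic_to_NF n A \<longleftrightarrow>
     (\<exists>\<phi> :: (nat \<Rightarrow> 'f) \<Rightarrow> 'a.
        bij_betw \<phi> (NF_carrier n) A \<and>
        (\<forall>v\<in>NF_carrier n. \<forall>w\<in>NF_carrier n. \<phi> (\<lambda>k. v k + w k) = \<phi> v + \<phi> w) \<and>
        (\<forall>c. \<forall>v\<in>NF_carrier n. \<phi> (\<lambda>k. c * v k) = scale c (\<phi> v)) \<and>
        (\<forall>v\<in>NF_carrier n. \<forall>w\<in>NF_carrier n.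
            \<phi> (NF_bracket n v w) = bracket (\<phi> v) (\<phi> w)))"

end

end

theory Submission
  imports Defs
begin

text \<open>Right multiplication by \<open>y\<close> is a derivation of \<open>N = NF\<^sub>n\<close>, hence triangular in the basis
  \<open>e\<^sub>i\<close> with eigenvalues \<open>i w(y)\<close>, where \<open>w\<close> is a linear functional vanishing on all brackets. An
  ideal inside \<open>ker w\<close> that contains \<open>N\<close> and has its brackets in \<open>N\<close> is nilpotent, so by solvability
  and maximality \<open>ker w = N\<close>, and \<open>N\<close> has codimension one. Take \<open>x\<close> with \<open>w(x) = -1\<close>. Since
  \<open>e\<^sub>2, \<dots>, e\<^sub>n\<close> annihilate the algebra from the right, \<open>x\<close> may be changed by a combination of them to
  make \<open>[x, x] = 0\<close>; replacing \<open>e\<^sub>1\<close> by \<open>[x, e\<^sub>1]\<close> then gives the table.\<close>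

context leibniz_algebra
begin

section \<open>Bilinearity and ideals in a Leibniz algebra\<close>

lemma bracket_add_left: "bracket (x + y) z = bracket x z + bracket y z"
  and bracket_add_right: "bracket x (y + z) = bracket x y + bracket x z"
  and bracket_diff_left: "bracket (x - y) z = bracket x z - bracket y z"
  and bracket_diff_right: "bracket x (y - z) = bracket x y - bracket x z"
  and bracket_minus_left: "bracket (- x) z = - bracket x z"
  and bracket_minus_right: "bracket x (- z) = - bracket x z"
  and bracket_scale_left: "bracket (scale c x) y = scale c (bracket x y)"
  and bracket_scale_right: "bracket x (scale c y) = scale c (bracket x y)"
  and bracket_zero_left [simp]: "bracket 0 y = 0"
  and bracket_zero_right [simp]: "bracket x 0 = 0"
proof -
  note l = linear_bracket_left[unfolded linear_iff_module_hom]
  note r = linear_bracket_right[unfolded linear_iff_module_hom]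
  show "bracket (x + y) z = bracket x z + bracket y z" by (rule module_hom.add[OF l])
  show "bracket x (y + z) = bracket x y + bracket x z" by (rule module_hom.add[OF r])
  show "bracket (x - y) z = bracket x z - bracket y z" by (rule module_hom.diff[OF l])
  show "bracket x (y - z) = bracket x y - bracket x z" by (rule module_hom.diff[OF r])
  show "bracket (- x) z = - bracket x z" by (rule module_hom.neg[OF l])
  show "bracket x (- z) = - bracket x z" by (rule module_hom.neg[OF r])
  show "bracket (scale c x) y = scale c (bracket x y)" by (rule module_hom.scale[OF l])
  show "bracket x (scale c y) = scale c (bracket x y)" by (rule module_hom.scale[OF r])
  show "bracket 0 y = 0" by (rule module_hom.zero[OF l])
  show "bracket x 0 = 0" by (rule module_hom.zero[OF r])
qed

lemmas bracket_linear =
  bracket_add_left bracket_add_right bracket_diff_left bracket_diff_right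
  bracket_minus_left bracket_minus_right bracket_scale_left bracket_scale_right

lemma bracket_bracket_left:
  "bracket (bracket x y) z = bracket x (bracket y z) + bracket (bracket x z) y"
  by (simp add: leibniz_identity)

text \<open>Exchanging \<open>x\<close> and \<open>y\<close> negates the Leibniz expansion. The
  bracket itself need not be antisymmetric, only its effect as a right factor.\<close>

lemma bracket_anticommutes_right: "bracket z (bracket x y) = - bracket z (bracket y x)"
  by (simp add: leibniz_identity)

lemma bracket_square_right: "bracket z (bracket x x) = 0"
  by (simp add: leibniz_identity)

text \<open>By linearity a claim about a span reduces to its generators; this lemma and its mirror
  image carry facts about the basis over to the layers.\<close>

lemma bracket_span_in_left:
  assumes "x \<in> span A" "subspace S" "\<And>a. a \<in> A \<Longrightarrow> bracket a y \<in> S"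
  shows "bracket x y \<in> S"
  using assms(1)
  by (induction rule: span_induct_alt)
    (auto simp: bracket_linear assms subspace_0 intro!: subspace_add subspace_scale)

lemma bracket_span_in_right:
  assumes "y \<in> span A" "subspace S" "\<And>a. a \<in> A \<Longrightarrow> bracket x a \<in> S"
  shows "bracket x y \<in> S"
  using assms(1)
  by (induction rule: span_induct_alt)
    (auto simp: bracket_linear assms subspace_0 intro!: subspace_add subspace_scale)

lemma subspace_bracket_span: "subspace (bracket_span A B)"
  by (simp add: bracket_span_def)

lemma bracket_in_bracket_span: "a \<in> A \<Longrightarrow> b \<in> B \<Longrightarrow> bracket a b \<in> bracket_span A B"
  unfolding bracket_span_def by (intro span_base) auto

lemma bracket_span_subset:
  assumes "subspace S" "\<And>a b. a \<in> A \<Longrightarrow> b \<in> B \<Longrightarrow> bracket a b \<in> S"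
  shows "bracket_span A B \<subseteq> S"
  unfolding bracket_span_def using assms by (intro span_minimal) auto

text \<open>From the right, \<open>y\<close> acts as a derivation; from the left, the Leibniz
  identity gives a difference of two brackets of elements of \<open>I\<close>.\<close>

lemma two_sided_ideal_bracket_span:
  assumes I: "two_sided_ideal I"
  shows "two_sided_ideal (bracket_span I I)"
  unfolding two_sided_ideal_def
proof (intro conjI ballI allI)
  show "subspace (bracket_span I I)" by (rule subspace_bracket_span)
  fix a y assume a: "a \<in> bracket_span I I"
  have c: "bracket u y \<in> I" "bracket y u \<in> I" if "u \<in> I" for u
    using I that by (auto simp: two_sided_ideal_def)
  note gen = a[unfolded bracket_span_def[of I I]]
  show "bracket a y \<in> bracket_span I I"
  proof (rule bracket_span_in_left[OF gen subspace_bracket_span])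
    fix b assume "b \<in> {bracket u v |u v. u \<in> I \<and> v \<in> I}"
    then obtain u v where "b = bracket u v" "u \<in> I" "v \<in> I" by blast
    then show "bracket b y \<in> bracket_span I I"
      by (auto intro!: subspace_add subspace_bracket_span bracket_in_bracket_span c
          simp: bracket_bracket_left[of u v y])
  qed
  show "bracket y a \<in> bracket_span I I"
  proof (rule bracket_span_in_right[OF gen subspace_bracket_span])
    fix b assume "b \<in> {bracket u v |u v. u \<in> I \<and> v \<in> I}"
    then obtain u v where "b = bracket u v" "u \<in> I" "v \<in> I" by blast
    then show "bracket y b \<in> bracket_span I I"
      by (auto intro!: subspace_diff subspace_bracket_span bracket_in_bracket_span c
          simp: leibniz_identity)
  qed
qed

lemma two_sided_ideal_derived: "two_sided_ideal (derived UNIV k)"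
proof (induction k)
  case 0
  show ?case by (simp add: two_sided_ideal_def)
qed (simp add: two_sided_ideal_bracket_span)

end

section \<open>A null-filiform ideal and its filtration by tails of the basis\<close>

text \<open>Setting \<open>e i\<close> to zero beyond \<open>n\<close> lets
  \<open>bracket_e_1\<close> hold for every i \<ge> 1, with no exception at
  \<open>i = n\<close>.\<close>

locale null_filiform_ideal = leibniz_algebra scale bracket
  for scale :: "'f::field_char_0 \<Rightarrow> 'a::ab_group_add \<Rightarrow> 'a"
    and bracket :: "'a \<Rightarrow> 'a \<Rightarrow> 'a" +
  fixes N :: "'a set" and n :: nat and e :: "nat \<Rightarrow> 'a"
  assumes n_ge_2: "2 \<le> n"
    and ideal: "two_sided_ideal N"
    and inj_e: "inj_on e {1..n}"
    and independent_e: "independent (e ` {1..n})"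
    and N_eq: "N = span (e ` {1..n})"
    and e_beyond: "n < i \<Longrightarrow> e i = 0"
    and bracket_e_1: "1 \<le> i \<Longrightarrow> bracket (e i) (e 1) = e (Suc i)"
    and bracket_e_e: "1 \<le> i \<Longrightarrow> 2 \<le> j \<Longrightarrow> bracket (e i) (e j) = 0"
begin

declare One_nat_def [simp del]

text \<open>For k \<ge> 1 this is the k-th term of the lower central series of
  \<open>N\<close>.\<close>

definition layer :: "nat \<Rightarrow> 'a set" where
  "layer k = span (e ` {k..})"

lemma subspace_layer: "subspace (layer k)"
  by (simp add: layer_def)

lemmas layer_closed =
  subspace_0[OF subspace_layer] subspace_add[OF subspace_layer] subspace_diff[OF subspace_layer]
  subspace_scale[OF subspace_layer] subspace_neg[OF subspace_layer]

lemma e_in_layer: "k \<le> i \<Longrightarrow> e i \<in> layer k"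
  unfolding layer_def by (intro span_base) auto

lemma layer_antimono: "j \<le> k \<Longrightarrow> layer k \<subseteq> layer j"
  unfolding layer_def by (intro span_mono) auto

lemma layer_antimonoD: "y \<in> layer k \<Longrightarrow> j \<le> k \<Longrightarrow> y \<in> layer j"
  using layer_antimono by blast

lemma layer_eq_span: "layer k = span (e ` {k..n})"
proof
  show "layer k \<subseteq> span (e ` {k..n})"
    unfolding layer_def
  proof (intro span_minimal subsetI)
    fix y assume "y \<in> e ` {k..}"
    then obtain i where "k \<le> i" "y = e i" by auto
    then show "y \<in> span (e ` {k..n})"
      by (cases "i \<le> n") (auto simp: e_beyond span_zero intro: span_base)
  qed simp
  show "span (e ` {k..n}) \<subseteq> layer k"
    unfolding layer_def by (intro span_mono) auto
qed

lemma layer_1: "layer 1 = N"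
  by (simp add: layer_eq_span N_eq)

lemma layer_beyond: "n < k \<Longrightarrow> layer k = {0}"
  by (simp add: layer_eq_span)

lemma layer_leading_coefficient:
  assumes "y \<in> layer k"
  obtains c where "y - scale c (e k) \<in> layer (Suc k)"
proof -
  have "{k..} = insert k {Suc k..}" by auto
  then show thesis
    using assms that by (auto simp: layer_def span_breakdown_eq)
qed

lemma e_notin_layer: "i \<in> {1..n} \<Longrightarrow> e i \<notin> layer (Suc i)"
proof
  assume i: "i \<in> {1..n}" and "e i \<in> layer (Suc i)"
  moreover have "e ` {Suc i..n} \<subseteq> e ` {1..n} - {e i}"
    using i inj_e by (auto dest: inj_onD)
  ultimately have "e i \<in> span (e ` {1..n} - {e i})"
    using span_mono[of "e ` {Suc i..n}"] by (auto simp: layer_eq_span)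
  then show False
    using i independent_e by (auto simp: dependent_def)
qed

lemma e_nonzero: "i \<in> {1..n} \<Longrightarrow> e i \<noteq> 0"
  using e_notin_layer layer_closed(1) by metis

text \<open>Left factors in \<open>N\<close> are covered by \<open>bracket_e_e\<close>. For
  arbitrary \<open>y\<close>, \<open>e 2\<close> is the square of \<open>e 1\<close>, and squares
  act as zero from the right; for \<open>e (Suc j)\<close> the Leibniz identity leaves only
  \<open>bracket (bracket y (e 1)) (e j)\<close>, whose left factor lies in
  \<open>N\<close>.\<close>

lemma bracket_e_right_zero:
  assumes "2 \<le> j"
  shows "bracket y (e j) = 0"
  using assms
proof (induction j rule: dec_induct)
  case base
  show ?case
    using bracket_square_right[of y "e 1"] bracket_e_1[of 1] by simp
next
  case (step j)
  then have "bracket y (e (Suc j)) = bracket y (bracket (e j) (e 1))"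
    by (simp add: bracket_e_1)
  also have "\<dots> = - bracket (bracket y (e 1)) (e j)"
    by (simp add: leibniz_identity step.IH)
  also have "bracket (bracket y (e 1)) (e j) = 0"
  proof -
    have "bracket y (e 1) \<in> span (e ` {1..n})"
      using ideal n_ge_2 span_base[of "e 1" "e ` {1..n}"] by (auto simp: two_sided_ideal_def N_eq)
    then have "bracket (bracket y (e 1)) (e j) \<in> {0}"
      using step.hyps by (rule_tac bracket_span_in_left) (auto simp: bracket_e_e)
    then show ?thesis by simp
  qed
  finally show ?case by simp
qed

lemma bracket_layer_2_right:
  assumes "u \<in> layer 2"
  shows "bracket y u = 0"
proof -
  have "bracket y u \<in> {0}"
    using assms unfolding layer_def
    by (rule bracket_span_in_right) (auto simp: bracket_e_right_zero)
  then show ?thesis by simp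
qed

lemma bracket_layer_e_1:
  assumes "u \<in> layer k" "1 \<le> k"
  shows "bracket u (e 1) \<in> layer (Suc k)"
  using assms(1) unfolding layer_def[of k]
  by (rule bracket_span_in_left) (use assms(2) in \<open>auto simp: bracket_e_1 subspace_layer e_in_layer\<close>)

lemma bracket_N: "u \<in> N \<Longrightarrow> bracket u y \<in> N" "u \<in> N \<Longrightarrow> bracket y u \<in> N"
  using ideal by (auto simp: two_sided_ideal_def)

lemma e_in_N: "1 \<le> i \<Longrightarrow> e i \<in> N"
  using e_in_layer layer_1 by blast

section \<open>The weight functional\<close>

text \<open>The eigenvalue of right multiplication by \<open>y\<close> on the line \<open>N / [N, N]\<close>.\<close>

definition weight :: "'a \<Rightarrow> 'f" where
  "weight y = (SOME c. bracket (e 1) y - scale c (e 1) \<in> layer 2)"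

lemma bracket_e_1_weight: "bracket (e 1) y - scale (weight y) (e 1) \<in> layer 2"
proof -
  have "bracket (e 1) y \<in> layer 1" by (simp add: layer_1 bracket_N e_in_N)
  then obtain c where "bracket (e 1) y - scale c (e 1) \<in> layer (Suc 1)"
    by (rule layer_leading_coefficient)
  then have "\<exists>c. bracket (e 1) y - scale c (e 1) \<in> layer 2"
    by auto
  then show ?thesis
    unfolding weight_def by (rule someI_ex)
qed

text \<open>Two admissible values would put a nonzero multiple of \<open>e 1\<close> into
  \<open>layer 2\<close>. Weights are computed through this lemma.\<close>

lemma weight_unique:
  assumes "bracket (e 1) y - scale c (e 1) \<in> layer 2"
  shows "weight y = c"
proof (rule ccontr)
  assume ne: "weight y \<noteq> c"
  have "scale (c - weight y) (e 1) \<in> layer 2"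
    using layer_closed(3)[OF bracket_e_1_weight[of y] assms] by (simp add: scale_left_diff_distrib)
  then have "e 1 \<in> layer 2"
    using layer_closed(4)[of "scale (c - weight y) (e 1)" 2 "inverse (c - weight y)"] ne by simp
  then show False
    using e_notin_layer[of 1] n_ge_2 by simp
qed

lemma weight_add: "weight (y + z) = weight y + weight z"
  using layer_closed(2)[OF bracket_e_1_weight[of y] bracket_e_1_weight[of z]]
  by (intro weight_unique) (simp add: bracket_linear scale_left_distrib algebra_simps)

lemma weight_scale: "weight (scale c y) = c * weight y"
  using layer_closed(4)[OF bracket_e_1_weight[of y], of c]
  by (intro weight_unique) (simp add: bracket_linear scale_right_diff_distrib)

lemma weight_diff: "weight (y - z) = weight y - weight z"
  using weight_add[of "y - z" z] by simp

text \<open>Since \<open>e (Suc i)\<close> is the bracket of \<open>e i\<close> and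
  \<open>e 1\<close>, the derivation rule adds one more \<open>weight y\<close> at each step. The
  error of \<open>bracket (e 1) y\<close> lies in \<open>layer 2\<close> and vanishes as a right
  factor.\<close>

lemma bracket_e_weight:
  assumes "1 \<le> i"
  shows "bracket (e i) y - scale (of_nat i * weight y) (e i) \<in> layer (Suc i)"
  using assms
proof (induction i rule: dec_induct)
  case base
  show ?case using bracket_e_1_weight by simp
next
  case (step i)
  have "bracket (e i) (bracket (e 1) y - scale (weight y) (e 1)) = 0"
    by (rule bracket_layer_2_right[OF bracket_e_1_weight])
  then have 1: "bracket (e i) (bracket (e 1) y) = scale (weight y) (e (Suc i))"
    using step.hyps by (simp add: bracket_linear bracket_e_1)
  have "bracket (e (Suc i)) y - scale (of_nat (Suc i) * weight y) (e (Suc i)) =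
      bracket (bracket (e i) y - scale (of_nat i * weight y) (e i)) (e 1)"
    using 1 step.hyps bracket_bracket_left[of "e i" "e 1" y]
    by (simp add: bracket_linear bracket_e_1 scale_left_distrib algebra_simps)
  then show ?case
    using bracket_layer_e_1[OF step.IH] by simp
qed

lemma bracket_layer:
  assumes "u \<in> layer k" "1 \<le> k"
  shows "bracket u y \<in> layer k"
  using assms(1) unfolding layer_def[of k]
proof (rule bracket_span_in_left; simp flip: layer_def add: subspace_layer)
  fix a assume "a \<in> e ` {k..}"
  then obtain i where i: "a = e i" "k \<le> i" by auto
  have "bracket (e i) y - scale (of_nat i * weight y) (e i) \<in> layer k"
    using i assms(2) by (intro layer_antimonoD[OF bracket_e_weight]) auto
  from layer_closed(2)[OF this layer_closed(4)[OF e_in_layer[OF i(2)], of "of_nat i * weight y"]]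
  show "bracket a y \<in> layer k"
    by (simp add: i)
qed

text \<open>With weight 0 the diagonal vanishes and the action is strictly triangular; iterating it
  will give nilpotency.\<close>

lemma bracket_layer_weight_0:
  assumes "u \<in> layer k" "1 \<le> k" "weight y = 0"
  shows "bracket u y \<in> layer (Suc k)"
  using assms(1) unfolding layer_def[of k]
proof (rule bracket_span_in_left; simp add: subspace_layer)
  fix a assume "a \<in> e ` {k..}"
  then obtain i where i: "a = e i" "k \<le> i" by auto
  then show "bracket a y \<in> layer (Suc k)"
    using layer_antimonoD[OF bracket_e_weight[of i y], of "Suc k"] assms by simp
qed

text \<open>By the Leibniz identity, \<open>bracket y z\<close> acts from the right as a commutator
  of two right multiplications; on the line \<open>N / layer 2\<close> these are scalars and
  commute.\<close>

lemma weight_bracket: "weight (bracket y z) = 0"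
proof -
  define r where "r y = bracket (e 1) y - scale (weight y) (e 1)" for y
  have r: "bracket (r y) z \<in> layer 2" "r y \<in> layer 2" for y z
    using bracket_layer[OF bracket_e_1_weight] bracket_e_1_weight by (auto simp: r_def)
  have br: "bracket (e 1) y = scale (weight y) (e 1) + r y" for y
    by (simp add: r_def)
  have "bracket (e 1) (bracket y z) =
      scale (weight y) (r z) + bracket (r y) z - (scale (weight z) (r y) + bracket (r z) y)"
    unfolding leibniz_identity br bracket_add_left bracket_scale_left
    by (simp add: scale_right_distrib scale_scale mult.commute)
  also have "\<dots> \<in> layer 2"
    by (intro layer_closed r)
  finally show ?thesis
    by (intro weight_unique) simp
qed

lemma weight_N:
  assumes "u \<in> N"
  shows "weight u = 0"
proof -
  have "bracket (e 1) u \<in> layer 2"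
    using assms unfolding N_eq
  proof (rule bracket_span_in_right[OF _ subspace_layer])
    fix a assume "a \<in> e ` {1..n}"
    then obtain i where i: "a = e i" "1 \<le> i" by auto
    show "bracket (e 1) a \<in> layer 2"
      using i by (cases "i = 1") (auto simp: bracket_e_right_zero bracket_e_1 e_in_layer layer_closed)
  qed
  then show ?thesis
    by (intro weight_unique) simp
qed

text \<open>\<open>bracket (e 1) u\<close> is \<open>e 2\<close> times the coefficient of
  \<open>e 1\<close> in \<open>u\<close>, and \<open>e 2\<close> is nonzero as n \<ge> 2.\<close>

lemma N_annihilated_in_layer_2:
  assumes "u \<in> N" "bracket (e 1) u = 0"
  shows "u \<in> layer 2"
proof -
  obtain c where c: "u - scale c (e 1) \<in> layer 2"
    using assms(1) layer_leading_coefficient[of u 1] by (auto simp: layer_1[symmetric])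
  have "scale c (e 2) = 0"
    using bracket_layer_2_right[OF c, of "e 1"] assms(2) bracket_e_1[of 1]
    by (simp add: bracket_linear)
  then have "c = 0"
    using e_nonzero[of 2] n_ge_2 by simp
  then show ?thesis using c by simp
qed

section \<open>The kernel of the weight\<close>

text \<open>By descending induction on \<open>k\<close>, the intersection of \<open>ker w\<close> with \<open>derived UNIV k + N\<close>,
  called \<open>M k\<close> below, equals \<open>N\<close>.\<close>

lemma weight_kernel_eq_N:
  assumes max: "is_nilradical N" and "solvable UNIV"
  shows "{x. weight x = 0} = N"
proof -
  have sN: "subspace N" using ideal by (simp add: two_sided_ideal_def)
  define M where "M k = {x. weight x = 0 \<and> (\<exists>y\<in>derived UNIV k. x - y \<in> N)}" for k
  have d: "two_sided_ideal (derived UNIV k)" for k by (rule two_sided_ideal_derived)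
  then have sd: "subspace (derived UNIV k)" for k by (simp add: two_sided_ideal_def)
  have N_M: "N \<subseteq> M k" for k
    using weight_N subspace_0[OF sd] by (force simp: M_def)
  have ideal_M: "two_sided_ideal (M k)" for k
    unfolding two_sided_ideal_def
  proof (intro conjI ballI allI)
    show "subspace (M k)"
      unfolding subspace_def
    proof (intro conjI ballI allI)
      show "0 \<in> M k" using N_M subspace_0[OF sN] by blast
      fix x assume "x \<in> M k"
      then obtain y where y: "weight x = 0" "y \<in> derived UNIV k" "x - y \<in> N"
        by (auto simp: M_def)
      show "scale c x \<in> M k" for c
        using y subspace_scale[OF sd, of y k c] subspace_scale[OF sN, of "x - y" c]
        by (auto simp: M_def weight_scale scale_right_diff_distrib)
      fix x' assume "x' \<in> M k"
      then obtain y' where y': "weight x' = 0" "y' \<in> derived UNIV k" "x' - y' \<in> N"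
        by (auto simp: M_def)
      have "(x + x') - (y + y') \<in> N"
        using subspace_add[OF sN y(3) y'(3)] by (simp add: algebra_simps)
      then show "x + x' \<in> M k"
        using y y' subspace_add[OF sd y(2) y'(2)] by (auto simp: M_def weight_add)
    qed
    fix x z assume "x \<in> M k"
    then obtain y where y: "y \<in> derived UNIV k" "x - y \<in> N"
      by (auto simp: M_def)
    have "bracket y z \<in> derived UNIV k" "bracket z y \<in> derived UNIV k"
      using d y by (auto simp: two_sided_ideal_def)
    then show "bracket x z \<in> M k" "bracket z x \<in> M k"
      using bracket_N[OF y(2), of z] by (auto simp: M_def weight_bracket bracket_linear)
  qed
  \<comment> \<open>Brackets within \<open>M k\<close> land in \<open>N\<close>, and further
    brackets with weight-zero elements descend through the layers; so \<open>M k\<close> is a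
    nilpotent ideal containing \<open>N\<close>, and maximality applies.\<close>
  have M_step: "M k = N" if "M (Suc k) = N" for k
  proof -
    have MM: "bracket x x' \<in> N" if xx: "x \<in> M k" "x' \<in> M k" for x x'
    proof -
      obtain y y' where y: "y \<in> derived UNIV k" "x - y \<in> N" "y' \<in> derived UNIV k" "x' - y' \<in> N"
        using xx unfolding M_def by blast
      have "bracket x x' - bracket y y' = bracket (x - y) x' + bracket y (x' - y')"
        by (simp add: bracket_linear)
      also have "\<dots> \<in> N"
        using y by (intro subspace_add[OF sN] bracket_N)
      finally have "bracket x x' \<in> M (Suc k)"
        using y by (auto simp: M_def weight_bracket intro!: bracket_in_bracket_span)
      then show ?thesis using \<open>M (Suc k) = N\<close> by simp
    qed
    \<comment> \<open>The first bracketing only reaches \<open>N = layer 1\<close>; each later one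
      gains a layer, so \<open>Suc n\<close> of them reach \<open>layer (Suc n)\<close>, which is
      zero.\<close>
    have lc: "lower_central (M k) (Suc i) \<subseteq> layer (Suc i)" for i
    proof (induction i)
      case 0
      have "bracket_span (M k) (M k) \<subseteq> layer 1"
        using MM layer_1 by (intro bracket_span_subset subspace_layer) auto
      then show ?case by (simp add: One_nat_def)
    next
      case (Suc i)
      have "bracket_span (lower_central (M k) (Suc i)) (M k) \<subseteq> layer (Suc (Suc i))"
        using Suc.IH
        by (intro bracket_span_subset subspace_layer bracket_layer_weight_0) (auto simp: M_def)
      then show ?case by simp
    qed
    have "lower_central (M k) (Suc n) = {0}"
      using lc[of n] subspace_0[OF subspace_bracket_span] by (auto simp: layer_beyond)
    then have "nilpotent (M k)"
      unfolding nilpotent_def by blast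
    then show ?thesis
      using max ideal_M N_M by (auto simp: is_nilradical_def)
  qed
  obtain k where "derived UNIV k = {0}"
    using assms(2) by (auto simp: solvable_def)
  then have "M k = N"
    using N_M by (auto simp: M_def)
  then have "M 0 = N"
  proof (induction k)
    case (Suc k)
    then show ?case using M_step by blast
  qed
  \<comment> \<open>\<open>derived UNIV 0\<close> is the whole algebra, so \<open>y = x\<close>
    always qualifies and \<open>M 0\<close> is the full kernel.\<close>
  moreover have "\<exists>y. x - y \<in> N" for x
    using subspace_0[OF sN] by (intro exI[of _ x]) simp
  then have "M 0 = {x. weight x = 0}"
    by (simp add: M_def)
  ultimately show ?thesis by simp
qed

section \<open>Normal form of the multiplication table\<close>

text \<open>Adding an element of \<open>[N, N]\<close> to \<open>y\<close> does not change right multiplication by \<open>y\<close>,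
  which acts on \<open>[N, N]\<close> with the nonzero eigenvalues \<open>-2, \<dots>, -n\<close>; so the leading
  coefficients of \<open>[y, y]\<close> can be removed one at a time.\<close>

lemma square_zero_of_weight_minus_1:
  assumes ker: "{x. weight x = 0} = N" and "weight x = - 1"
  obtains y where "weight y = - 1" "bracket y y = 0"
proof -
  have "\<exists>y. weight y = - 1 \<and> bracket y y \<in> layer k" if "2 \<le> k" for k
    using that
  proof (induction k rule: dec_induct)
    case base
    \<comment> \<open>The square has weight 0, so it lies in \<open>N\<close>; as it annihilates
      \<open>e 1\<close> from the right, it has no \<open>e 1\<close> component.\<close>
    have "bracket x x \<in> N"
      using ker weight_bracket by blast
    then show ?case
      using assms(2) N_annihilated_in_layer_2 bracket_square_right by blast
  next
    case (step k)
    then obtain y c where y: "weight y = - 1" "bracket y y - scale c (e k) \<in> layer (Suc k)"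
      by (metis layer_leading_coefficient)
    \<comment> \<open>As \<open>u\<close> vanishes as a right factor, the square of
      \<open>y + u\<close> is \<open>bracket y y + bracket u y\<close>. On \<open>e k\<close>,
      \<open>y\<close> has eigenvalue \<open>- k\<close> modulo \<open>layer (Suc k)\<close>, so
      this multiple cancels \<open>c\<close>; characteristic 0 permits the division.\<close>
    define u where "u = scale (c / of_nat k) (e k)"
    have u: "u \<in> layer 2"
      using step.hyps by (auto simp: u_def intro: layer_closed e_in_layer)
    then have "u \<in> N"
      using layer_antimonoD[of u 2 1] layer_1 by auto
    then have w: "weight (y + u) = - 1"
      by (simp add: weight_add weight_N y)
    have k: "(of_nat k :: 'f) \<noteq> 0" using step.hyps by simp
    have "bracket (y + u) (y + u) = (bracket y y - scale c (e k)) +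
        scale (c / of_nat k) (bracket (e k) y - scale (of_nat k * weight y) (e k))"
      using k by (simp add: bracket_add_right[of _ y u] bracket_layer_2_right[OF u])
        (simp add: u_def bracket_linear y scale_right_distrib)
    also have "\<dots> \<in> layer (Suc k)"
      using step.hyps by (intro layer_closed y bracket_e_weight) auto
    finally show ?case using w by blast
  qed
  from this[of "Suc n"] show thesis
    using that n_ge_2 by (auto simp: layer_beyond)
qed

text \<open>Changes by \<open>layer 2\<close> do not alter right factors, so replacing
  \<open>e 1\<close> by \<open>bracket x (e 1)\<close> keeps the relations inside \<open>N\<close>
  and makes those with \<open>x\<close> exact instead of valid modulo deeper layers.\<close>

lemma normal_form:
  assumes fin: "finite_dimensional_vector_space scale B"
    and ker: "{x. weight x = 0} = N" and "weight x = - 1" and sq: "bracket x x = 0"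
  shows "\<exists>f. inj_on f {1..n} \<and> x \<notin> f ` {1..n} \<and>
      independent (insert x (f ` {1..n})) \<and> span (insert x (f ` {1..n})) = UNIV \<and>
      (\<forall>i\<in>{1..n}. \<forall>j\<in>{1..n}.
          bracket (f i) (f j) = (if j = 1 \<and> i \<le> n - 1 then f (i + 1) else 0)) \<and>
      (\<forall>j\<in>{1..n}. bracket x (f j) = (if j = 1 then f 1 else 0)) \<and>
      (\<forall>i\<in>{1..n}. bracket (f i) x = scale (- of_nat i) (f i))"
proof -
  interpret fd: finite_dimensional_vector_space scale B by (rule fin)
  define f where "f i = ((\<lambda>y. bracket y (e 1)) ^^ (i - 1)) (bracket x (e 1))" for i
  have f_1: "f 1 = bracket x (e 1)" by (simp add: f_def)
  have f_Suc: "f (Suc i) = bracket (f i) (e 1)" if "1 \<le> i" for i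
    using that by (cases i) (auto simp: f_def)
  have e_1_x: "bracket (e 1) x + e 1 \<in> layer 2"
    using bracket_e_1_weight[of x] by (simp add: assms(3))
  have f_1_e_1: "f 1 - e 1 \<in> layer 2"
  proof (rule N_annihilated_in_layer_2)
    show "f 1 - e 1 \<in> N"
      using ideal e_in_N[of 1] by (auto simp: f_1 two_sided_ideal_def intro!: subspace_diff)
    \<comment> \<open>As a right factor, \<open>bracket x (e 1)\<close> acts like minus
      \<open>bracket (e 1) x\<close>, which is \<open>e 1\<close> modulo
      \<open>layer 2\<close>.\<close>
    have "bracket (e 1) (f 1 - e 1) = - bracket (e 1) (bracket (e 1) x + e 1)"
      using bracket_anticommutes_right[of "e 1" x "e 1"] by (simp add: f_1 bracket_linear)
    then show "bracket (e 1) (f 1 - e 1) = 0"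
      by (simp add: bracket_layer_2_right[OF e_1_x])
  qed
  have f_e: "f i - e i \<in> layer (Suc i)" if "1 \<le> i" for i
    using that
  proof (induction i rule: dec_induct)
    case base
    show ?case using f_1_e_1 by simp
  next
    case (step i)
    then show ?case
      using bracket_layer_e_1[of "f i - e i" "Suc i"] by (simp add: f_Suc bracket_e_1 bracket_linear)
  qed
  have f_layer: "f i \<in> layer i" if "1 \<le> i" for i
    using layer_closed(2)[OF layer_antimonoD[OF f_e[OF that], of i] e_in_layer[of i i]] by simp
  have f_beyond: "f i = 0" if "n < i" for i
    using f_layer[of i] that by (simp add: layer_beyond)
  \<comment> \<open>For \<open>y = x\<close> this gives \<open>bracket x (f 1) = f 1\<close>, the
    reason for the choice of \<open>f 1\<close>.\<close>
  have r_1: "bracket y (f 1) = bracket y (e 1)" for y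
    using bracket_layer_2_right[OF f_1_e_1, of y] by (simp add: bracket_linear)
  have r_2: "bracket y (f j) = 0" if "2 \<le> j" for y j
    using that f_layer[of j] by (intro bracket_layer_2_right) (auto intro: layer_antimonoD)
  \<comment> \<open>Bracketing \<open>x\<close> with \<open>bracket (e 1) x + e 1\<close> gives 0;
    by the Leibniz identity and \<open>bracket x x = 0\<close> this reads
    \<open>bracket (f 1) x + f 1 = 0\<close>.\<close>
  have f_1_x: "bracket (f 1) x = - f 1"
    using bracket_layer_2_right[OF e_1_x, of x]
    by (simp add: bracket_linear f_1 eq_neg_iff_add_eq_0 leibniz_identity sq)
  have f_x: "bracket (f i) x = scale (- of_nat i) (f i)" if "1 \<le> i" for i
    using that
  proof (induction i rule: dec_induct)
    case base
    show ?case by (simp add: f_1_x)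
  next
    case (step i)
    \<comment> \<open>With \<open>f 1\<close> in place of \<open>e 1\<close>, the derivation rule
      adds the eigenvalues without error terms.\<close>
    have "f (Suc i) = bracket (f i) (f 1)" using step.hyps by (simp add: r_1 f_Suc)
    then show ?case
      using bracket_bracket_left[of "f i" "f 1" x] step.IH
      by (simp add: f_1_x bracket_linear scale_left_diff_distrib scale_left_distrib)
  qed
  have span_f: "span (f ` {1..n}) = N"
  proof
    show "span (f ` {1..n}) \<subseteq> N"
      using f_layer layer_antimonoD[of _ _ 1] layer_1 subspace_layer[of 1]
      by (intro span_minimal) fastforce+
    \<comment> \<open>\<open>f\<close> is unitriangular over \<open>e\<close>, so each
      \<open>e k\<close> is recovered from the last one downwards.\<close>
    have "layer k \<subseteq> span (f ` {1..n})" if "k \<le> Suc n" "1 \<le> k" for k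
      using that
    proof (induction k rule: inc_induct)
      case base
      then show ?case by (simp add: layer_beyond span_zero)
    next
      case (step k)
      have fk: "f k \<in> span (f ` {1..n})" using step by (intro span_base) auto
      have "f k - e k \<in> span (f ` {1..n})" using step f_e by auto
      from span_diff[OF fk this] have "e k \<in> span (f ` {1..n})" by simp
      moreover have "e ` {Suc k..} \<subseteq> span (f ` {1..n})"
        using step.IH e_in_layer[of "Suc k"] by auto
      moreover have "{k..} = insert k {Suc k..}" by auto
      ultimately show ?case
        unfolding layer_def by (intro span_minimal) auto
    qed
    from this[of 1] show "N \<subseteq> span (f ` {1..n})" by (simp add: layer_1[symmetric])
  qed
  \<comment> \<open>\<open>N\<close> has dimension \<open>n\<close>, so \<open>n\<close> vectors
    spanning it are distinct and independent.\<close>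
  have dim: "dim (f ` {1..n}) = n"
    using dim_eq_card[of "e ` {1..n}" "f ` {1..n}"] independent_e span_f N_eq
    by (simp add: card_image[OF inj_e])
  have card_f: "card (f ` {1..n}) = n"
  proof (rule antisym)
    show "card (f ` {1..n}) \<le> n" using card_image_le[of "{1..n}" f] by simp
    show "n \<le> card (f ` {1..n})" using dim_le_card'[of "f ` {1..n}"] dim by simp
  qed
  have inj: "inj_on f {1..n}"
    using card_f by (intro eq_card_imp_inj_on) auto
  have ind: "independent (f ` {1..n})"
    by (rule fd.card_le_dim_spanning[of _ "span (f ` {1..n})"])
      (auto simp: card_f dim intro: span_base)
  have x: "x \<notin> span (f ` {1..n})"
    using span_f weight_N assms(3) by auto
  have "y \<in> span (insert x (f ` {1..n}))" for y
  proof -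
    \<comment> \<open>As \<open>weight x = - 1\<close>, adding \<open>weight y\<close> times
      \<open>x\<close> moves \<open>y\<close> into the kernel; the signs fit
      \<open>span_breakdown_eq\<close>.\<close>
    have "weight (y - scale (- weight y) x) = 0"
      by (simp only: weight_diff weight_scale assms(3)) simp
    then show ?thesis
      using ker span_f unfolding span_breakdown_eq by blast
  qed
  moreover have "x \<notin> f ` {1..n}" using x span_base by blast
  moreover have "independent (insert x (f ` {1..n}))"
    using ind x by (rule_tac independent_insertI)
  moreover have "bracket (f i) (f j) = (if j = 1 \<and> i \<le> n - 1 then f (i + 1) else 0)"
    if "i \<in> {1..n}" "j \<in> {1..n}" for i j
  proof (cases "j = 1")
    case True
    then show ?thesis
      using that f_beyond[of "Suc i"] f_Suc[of i] r_1[of "f i"] by (auto simp flip: Suc_eq_plus1)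
  qed (use that r_2 in auto)
  moreover have "bracket x (f j) = (if j = 1 then f 1 else 0)" if "j \<in> {1..n}" for j
    using that r_1[of x] r_2[of j x] f_1 by auto
  ultimately show ?thesis
    using inj f_x by (intro exI[of _ f]) auto
qed

end

section \<open>From an isomorphism with the coordinate model to an adapted basis\<close>

context leibniz_algebra
begin

declare One_nat_def [simp del]

text \<open>\<phi> is linear only on the carrier, a set of functions, so span and independence are
  derived by hand from coordinates.\<close>

lemma isomorphic_to_NF_basis:
  assumes "isomorphic_to_NF n A" "1 \<le> n"
  obtains e where "inj_on e {1..n}" "independent (e ` {1..n})" "A = span (e ` {1..n})"
    "\<And>i. n < i \<Longrightarrow> e i = 0"
    "\<And>i. 1 \<le> i \<Longrightarrow> bracket (e i) (e 1) = e (Suc i)"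
    "\<And>i j. 1 \<le> i \<Longrightarrow> 2 \<le> j \<Longrightarrow> bracket (e i) (e j) = 0"
proof -
  obtain \<phi> :: "(nat \<Rightarrow> 'f) \<Rightarrow> 'a" where bij: "bij_betw \<phi> (NF_carrier n) A"
    and add: "\<And>v w. v \<in> NF_carrier n \<Longrightarrow> w \<in> NF_carrier n \<Longrightarrow> \<phi> (\<lambda>k. v k + w k) = \<phi> v + \<phi> w"
    and scl: "\<And>c v. v \<in> NF_carrier n \<Longrightarrow> \<phi> (\<lambda>k. c * v k) = scale c (\<phi> v)"
    and br: "\<And>v w. v \<in> NF_carrier n \<Longrightarrow> w \<in> NF_carrier n \<Longrightarrow>
      \<phi> (NF_bracket n v w) = bracket (\<phi> v) (\<phi> w)"
    using assms(1) unfolding isomorphic_to_NF_def by blast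
  have \<phi>_0: "\<phi> (\<lambda>k. 0) = 0"
    using scl[of "\<lambda>k. 0" 0] by (simp add: NF_carrier_def)
  have basis: "NF_basis i \<in> NF_carrier n" if "i \<in> {1..n}" for i
    using that by (auto simp: NF_carrier_def NF_basis_def)
  \<comment> \<open>The value 0 outside \<open>{1..n}\<close> supplies the zero tail required by
    \<open>e_beyond\<close>.\<close>
  define e where "e i = (if i \<in> {1..n} then \<phi> (NF_basis i) else 0)" for i
  \<comment> \<open>Additivity handles two vectors at a time, so \<open>v\<close> is truncated after
    coordinate \<open>m\<close>, with induction on \<open>m\<close>; coordinate 0 of a carrier
    vector is 0.\<close>
  have partial: "\<phi> (\<lambda>k. if k \<le> m then v k else 0) = (\<Sum>i=1..m. scale (v i) (e i))"
    if v: "v \<in> NF_carrier n" and m: "m \<le> n" for v m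
    using m
  proof (induction m)
    case 0
    have "(\<lambda>k. if k \<le> 0 then v k else 0) = (\<lambda>k. 0)"
      using v by (auto simp: NF_carrier_def)
    then show ?case by (simp add: \<phi>_0)
  next
    case (Suc m)
    have "(\<lambda>k. if k \<le> Suc m then v k else 0) =
        (\<lambda>k. (if k \<le> m then v k else 0) + v (Suc m) * NF_basis (Suc m) k)"
      by (auto simp: fun_eq_iff NF_basis_def le_Suc_eq)
    moreover have "\<phi> \<dots> = \<phi> (\<lambda>k. if k \<le> m then v k else 0) + scale (v (Suc m)) (e (Suc m))"
      using v Suc.prems basis[of "Suc m"]
      by (subst add) (auto simp: scl e_def NF_carrier_def)
    ultimately show ?case
      using Suc by simp
  qed
  have \<phi>_sum: "\<phi> v = (\<Sum>i=1..n. scale (v i) (e i))" if "v \<in> NF_carrier n" for v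
  proof -
    have "(\<lambda>k. if k \<le> n then v k else 0) = v"
      using that by (auto simp: NF_carrier_def)
    then show ?thesis using partial[OF that, of n] by simp
  qed
  have inj_\<phi>: "inj_on \<phi> (NF_carrier n)" and im: "\<phi> ` NF_carrier n = A"
    using bij by (auto simp: bij_betw_def)
  have inj: "inj_on e {1..n}"
  proof (rule inj_onI)
    fix i j assume ij: "i \<in> {1..n}" "j \<in> {1..n}" "e i = e j"
    then have "(NF_basis i :: nat \<Rightarrow> 'f) = NF_basis j"
      using inj_\<phi> basis by (auto simp: e_def dest: inj_onD)
    then have "(NF_basis i i :: 'f) = NF_basis j i" by simp
    then show "i = j" by (simp add: NF_basis_def split: if_splits)
  qed
  have ind: "independent (e ` {1..n})"
  proof (rule independent_if_scalars_zero)
    fix g y assume g: "(\<Sum>y\<in>e ` {1..n}. scale (g y) y) = 0" and "y \<in> e ` {1..n}"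
    then obtain i where i: "i \<in> {1..n}" "y = e i" by auto
    \<comment> \<open>The coefficients form a carrier vector that \<phi> maps to 0, so injectivity
      makes them vanish.\<close>
    define v where "v k = (if k \<in> {1..n} then g (e k) else 0)" for k
    have v: "v \<in> NF_carrier n" by (auto simp: v_def NF_carrier_def)
    have "\<phi> v = (\<Sum>i=1..n. scale (g (e i)) (e i))"
      by (simp add: \<phi>_sum[OF v] v_def)
    also have "\<dots> = 0"
      using g by (simp add: sum.reindex[OF inj])
    finally have "v = (\<lambda>k. 0)"
      using \<phi>_0 by (intro inj_onD[OF inj_\<phi> _ v]) (auto simp: NF_carrier_def)
    then have "v i = 0" by simp
    then show "g y = 0" using i by (simp add: v_def)
  qed simp
  have sub: "A \<subseteq> span (e ` {1..n})"
  proof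
    fix y assume "y \<in> A"
    then obtain v where "v \<in> NF_carrier n" "y = \<phi> v" using im by auto
    then show "y \<in> span (e ` {1..n})"
      by (auto simp: \<phi>_sum intro!: span_sum span_scale intro: span_base)
  qed
  have sup: "span (e ` {1..n}) \<subseteq> A"
  proof (rule span_minimal)
    show "e ` {1..n} \<subseteq> A"
      using basis by (auto simp: e_def im[symmetric] simp del: atLeastAtMost_iff)
    show "subspace A"
      unfolding subspace_def im[symmetric]
    proof (intro conjI ballI allI)
      show "0 \<in> \<phi> ` NF_carrier n"
        using \<phi>_0 by (intro image_eqI[of _ _ "\<lambda>k. 0"]) (auto simp: NF_carrier_def)
      fix x assume "x \<in> \<phi> ` NF_carrier n"
      then obtain v where v: "v \<in> NF_carrier n" "x = \<phi> v" by auto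
      show "scale c x \<in> \<phi> ` NF_carrier n" for c
        using v by (intro image_eqI[of _ _ "\<lambda>k. c * v k"]) (auto simp: scl NF_carrier_def)
      fix y assume "y \<in> \<phi> ` NF_carrier n"
      then obtain w where w: "w \<in> NF_carrier n" "y = \<phi> w" by auto
      show "x + y \<in> \<phi> ` NF_carrier n"
        using v w by (intro image_eqI[of _ _ "\<lambda>k. v k + w k"]) (auto simp: add NF_carrier_def)
    qed
  qed
  have e_br: "bracket (e i) (e j) = \<phi> (NF_table n i j)" if "i \<in> {1..n}" "j \<in> {1..n}" for i j
    using that by (simp add: e_def br[symmetric] basis NF_bracket_basis)
  show thesis
  proof
    show "inj_on e {1..n}" "independent (e ` {1..n})" by (fact inj ind)+
    show "A = span (e ` {1..n})" using sub sup by (rule antisym)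
    show "e i = 0" if "n < i" for i using that by (simp add: e_def)
    \<comment> \<open>At \<open>i = n\<close> the table entry is zero, in agreement with
      \<open>e (Suc n) = 0\<close>.\<close>
    show "bracket (e i) (e 1) = e (Suc i)" if "1 \<le> i" for i
    proof (cases "i \<le> n")
      case True
      then show ?thesis using that assms(2) by (auto simp: e_br NF_table_def \<phi>_0 e_def[of "Suc i"] simp flip: Suc_eq_plus1)
    qed (simp add: e_def)
    show "bracket (e i) (e j) = 0" if "1 \<le> i" "2 \<le> j" for i j
    proof (cases "i \<le> n \<and> j \<le> n")
      case True
      then show ?thesis using that by (simp add: e_br NF_table_def \<phi>_0)
    qed (auto simp: e_def)
  qed
qed

end

theorem theorem3p5:
  fixes scale :: "'f::field_char_0 \<Rightarrow> 'a::ab_group_add \<Rightarrow> 'a"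
    and bracket :: "'a \<Rightarrow> 'a \<Rightarrow> 'a"
    and N :: "'a set"
    and n :: nat
  assumes "leibniz_algebra scale bracket"
    and "\<exists>B. finite_dimensional_vector_space scale B"
    and "leibniz_algebra.solvable scale bracket UNIV"
    and "\<not> leibniz_algebra.nilpotent scale bracket UNIV"
    and "leibniz_algebra.is_nilradical scale bracket N"
    and "n \<ge> 2"
    and "leibniz_algebra.isomorphic_to_NF scale bracket n N"
  shows "\<exists>(e :: nat \<Rightarrow> 'a) (x :: 'a).
      inj_on e {1..n} \<and> x \<notin> e ` {1..n} \<and>
      \<not> module.dependent scale (insert x (e ` {1..n})) \<and>
      module.span scale (insert x (e ` {1..n})) = UNIV \<and>
      (\<forall>i\<in>{1..n}. \<forall>j\<in>{1..n}.
          bracket (e i) (e j) = (if j = 1 \<and> i \<le> n - 1 then e (i + 1) else 0)) \<and>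
      (\<forall>j\<in>{1..n}. bracket x (e j) = (if j = 1 then e 1 else 0)) \<and>
      (\<forall>i\<in>{1..n}. bracket (e i) x = scale (- of_nat i) (e i)) \<and>
      bracket x x = 0"
proof -
  interpret leibniz_algebra scale bracket by fact
  obtain e where "inj_on e {1..n}" "independent (e ` {1..n})" "N = span (e ` {1..n})"
    "\<And>i. n < i \<Longrightarrow> e i = 0"
    "\<And>i. 1 \<le> i \<Longrightarrow> bracket (e i) (e 1) = e (Suc i)"
    "\<And>i j. 1 \<le> i \<Longrightarrow> 2 \<le> j \<Longrightarrow> bracket (e i) (e j) = 0"
    using assms(6) by (auto intro: isomorphic_to_NF_basis[OF assms(7)])
  then interpret null_filiform_ideal scale bracket N n e
    using assms(5,6) by unfold_locales (auto simp: is_nilradical_def)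
  have ker: "{x. weight x = 0} = N"
    using assms(5,3) by (rule weight_kernel_eq_N)
  \<comment> \<open>\<open>N\<close> is nilpotent and the algebra is not, so some element lies
    outside the kernel of the weight.\<close>
  have "N \<noteq> UNIV"
    using assms(4,5) by (auto simp: is_nilradical_def)
  then obtain z where z: "weight z \<noteq> 0"
    using ker by auto
  \<comment> \<open>Weight -1 yields the eigenvalues -i of the table.\<close>
  then have "weight (scale (- inverse (weight z)) z) = - 1"
    by (simp only: weight_scale) simp
  then obtain x where x: "weight x = - 1" "bracket x x = 0"
    using square_zero_of_weight_minus_1[OF ker] by blast
  obtain B where "finite_dimensional_vector_space scale B"
    using assms(2) by blast
  from normal_form[OF this ker x] show ?thesis
    using x(2) by blast
qed

end
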